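(* Let $\sigma$ be an s-finite measure on a standard Borel space $T$. Then there exists a (total) measurable function $d:\mathbb{R}\to T$ such that $\sigma=d_*(\mathbb{U}_{\mathbb{R}})$ if and only if $\sigma(T)=\infty$.
   Context: A measure is s-finite if it is a countable sum of finite measures. $\mathbb{U}_{\mathbb{R}}$ is the Lebesgue measure on $\mathbb{R}$ with its Borel $\sigma$-algebra, and $d_*m$ denotes the pushforward measure $U\mapsto m(d^{-1}(U))$. A standard Borel space is a set with the Borel $\sigma$-algebra of some complete separable metric. *)

theory Defs
  imports "HOL-Analysis.Analysis"
begin

text \<open>The measure on \<open>M\<close> plays no role here: only its carrier and its \<open>\<sigma>\<close>-algebra do.
  The space may be empty.\<close>

definition standard_borel :: "'a measure \<Rightarrow> bool" where
  "standard_borel M \<longleftrightarrow>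
     (\<exists>m :: 'a metric. mspace m = space M \<and> mcomplete_of m \<and> separable_space (mtopology_of m) \<and>
        sets M = sigma_sets (mspace m) {U. openin (mtopology_of m) U})"

text \<open>Finite sums are included, by padding with zero measures.\<close>

definition s_finite_measure :: "'a measure \<Rightarrow> bool" where
  "s_finite_measure M \<longleftrightarrow>
     (\<exists>\<mu> :: nat \<Rightarrow> 'a measure.
        (\<forall>i. sets (\<mu> i) = sets M \<and> finite_measure (\<mu> i)) \<and>
        (\<forall>A\<in>sets M. emeasure M A = (\<Sum>i. emeasure (\<mu> i) A)))"

end

theory Submission
  imports Defs "HOL-Probability.Weak_Convergence"
begin

text \<open>A nonempty standard Borel space is a measurable retract of the real line, so it suffices to treat
  \<open>T = \<real>\<close>. There each finite summand of \<open>\<sigma>\<close> is the image of Lebesgue measure on an interval of length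
  its total mass under its quantile function. These intervals, laid end to end, fill the positive
  half-line because the masses sum to \<open>\<infinity>\<close>, and \<open>t \<mapsto> 2\<bar>t\<bar>\<close> maps Lebesgue measure on \<open>\<real>\<close> to
  Lebesgue measure on the half-line.\<close>

section \<open>Quantile functions of finite measures on the line\<close>

text \<open>The quantile function \<open>I\<close> is the pseudoinverse of the cdf: on the open
  interval, \<open>I t \<le> x\<close> holds iff \<open>t \<le> cdf M x\<close>. Up to a null set,
  the preimage of \<open>{..x}\<close> is therefore an initial segment of length
  \<open>cdf M x\<close>, and a finite Borel measure on the line is determined by its cdf.\<close>

lemma finite_borel_measure_quantile:
  assumes "finite_borel_measure M"
  shows "\<exists>q \<in> borel_measurable borel. \<forall>A \<in> sets borel.
    emeasure lborel ({0<..<measure M UNIV} \<inter> q -` A) = emeasure M A"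
proof -
  interpret finite_borel_measure M by fact
  define a where "a = measure M UNIV"
  interpret right_continuous_mono "cdf M" 0 a
    using cdf_nondecreasing cdf_is_right_cont cdf_lim_at_top cdf_lim_at_bot
    by unfold_locales (auto simp: a_def borel_UNIV intro!: monoI)
  \<comment> \<open>\<open>I\<close> is well behaved and monotone only strictly between the two
    limits of the cdf; the value 0 elsewhere makes \<open>q\<close> a total Borel function.\<close>
  define q where "q t = (if t \<in> {0<..<a} then I t else 0)" for t
  have "I \<in> borel_measurable (restrict_space borel {0<..<a})"
    by (intro borel_measurable_mono_on_fnc mono_I)
  then have q[measurable]: "q \<in> borel_measurable borel"
    unfolding q_def by (subst measurable_If_restrict_space_iff)
      (simp_all del: greaterThanLessThan_iff)
  let ?\<Omega> = "restrict_space lborel {0<..<a}"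
  have "0 \<le> a"
    by (simp add: a_def)
  have q\<Omega>[measurable]: "q \<in> borel_measurable ?\<Omega>"
    by (intro measurable_restrict_space1) simp
  have distr_q: "emeasure (distr ?\<Omega> borel q) A = emeasure lborel ({0<..<a} \<inter> q -` A)"
    if "A \<in> sets borel" for A
  proof -
    have "q -` A \<in> sets borel"
      using measurable_sets[OF q that] by simp
    with that show ?thesis
      by (simp add: emeasure_distr space_restrict_space emeasure_restrict_space Int_commute)
  qed
  have "distr ?\<Omega> borel q = M"
  proof (rule cdf_unique'[OF _ assms ext])
    have "emeasure lborel ({0<..<a} \<inter> q -` UNIV) < \<infinity>"
      using \<open>0 \<le> a\<close> by simp
    then have "finite_measure (distr ?\<Omega> borel q)"
      by (intro finite_measureI) (simp add: distr_q)
    then show "finite_borel_measure (distr ?\<Omega> borel q)"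
      by (simp add: finite_borel_measure_def finite_borel_measure_axioms_def)
  next
    fix x
    have C: "0 \<le> cdf M x" "cdf M x \<le> a"
      using cdf_nonneg cdf_bounded by (auto simp: a_def borel_UNIV)
    have "emeasure (distr ?\<Omega> borel q) {..x} = emeasure lborel ({0<..<a} \<inter> q -` {..x})"
      by (simp add: distr_q)
    also have "\<dots> = emeasure lborel {0<..<cdf M x}"
    proof (rule emeasure_eq_AE)
      \<comment> \<open>After rewriting by the pseudoinverse, the two sets can differ only at the
        endpoint \<open>t = cdf M x\<close>.\<close>
      show "AE t in lborel. (t \<in> {0<..<a} \<inter> q -` {..x}) = (t \<in> {0<..<cdf M x})"
        using AE_lborel_singleton[of "cdf M x"]
        by eventually_elim (use C pseudoinverse[of _ x, symmetric] in \<open>auto simp: q_def\<close>)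
    qed auto
    also have "\<dots> = ennreal (cdf M x)"
      using C by simp
    finally show "cdf (distr ?\<Omega> borel q) x = cdf M x"
      using C by (simp add: cdf_def measure_def)
  qed
  with distr_q q show ?thesis
    by (intro bexI[of _ q]) (auto simp: a_def)
qed

section \<open>Lebesgue measure under translation, scaling and folding\<close>

lemma emeasure_lborel_translate:
  assumes [measurable]: "A \<in> sets borel"
  shows "emeasure lborel ((\<lambda>t::real. t - c) -` A) = emeasure lborel A"
proof -
  have "emeasure lborel A = emeasure (distr lborel borel ((+) (- c))) A"
    by (simp add: lborel_distr_plus)
  also have "\<dots> = emeasure lborel ((\<lambda>t. t - c) -` A)"
    by (subst emeasure_distr) (auto simp: vimage_def)
  finally show ?thesis ..
qed

lemma emeasure_lborel_scale:
  assumes [measurable]: "A \<in> sets borel" and "c \<noteq> (0::real)"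
  shows "emeasure lborel ((\<lambda>t. c * t) -` A) = ennreal (inverse \<bar>c\<bar>) * emeasure lborel A"
proof -
  have "emeasure lborel ((\<lambda>t. c * t) -` A) = emeasure (distr lborel borel ((*) c)) A"
    by (subst emeasure_distr) auto
  also have "\<dots> = ennreal (inverse \<bar>c\<bar>) * emeasure lborel A"
    unfolding lborel_distr_mult[OF assms(2)] by (simp add: emeasure_density nn_integral_cmult_indicator)
  finally show ?thesis .
qed

text \<open>The map covers the half-line twice, once from each side of 0. Stretching by 2 halves the
  measure of each of the two preimages, so together they restore it.\<close>

lemma emeasure_lborel_fold:
  assumes [measurable]: "A \<in> sets borel"
  shows "emeasure lborel ((\<lambda>t::real. 2 * \<bar>t\<bar>) -` A) = emeasure lborel ({0<..} \<inter> A)"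
proof -
  let ?B = "{0<..} \<inter> A"
  have half: "emeasure lborel ((\<lambda>t. c * t) -` ?B) = ennreal (1/2) * emeasure lborel ?B"
    if "\<bar>c\<bar> = 2" for c
    using emeasure_lborel_scale[of ?B c] that by (auto simp: inverse_eq_divide)
  have [measurable]: "(\<lambda>t. c * t) -` ?B \<in> sets borel" for c
    using measurable_sets[of "\<lambda>t. c * t" borel borel ?B] by simp
  have "emeasure lborel ((\<lambda>t. 2 * \<bar>t\<bar>) -` A) =
      emeasure lborel ((\<lambda>t. 2 * t) -` ?B \<union> (\<lambda>t. - 2 * t) -` ?B)"
  proof (rule emeasure_eq_AE)
    show "AE t in lborel. (t \<in> (\<lambda>t. 2 * \<bar>t\<bar>) -` A) =
        (t \<in> (\<lambda>t. 2 * t) -` ?B \<union> (\<lambda>t. - 2 * t) -` ?B)"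
      \<comment> \<open>The point 0 is exceptional: it is sent to 0, which may belong to
        \<open>A\<close> but not to \<open>?B\<close>.\<close>
      using AE_lborel_singleton[of 0] by eventually_elim (auto simp: abs_if)
    show "(\<lambda>t. 2 * \<bar>t\<bar>) -` A \<in> sets lborel"
      using measurable_sets[of "\<lambda>t. 2 * \<bar>t\<bar>" borel borel A] by simp
  qed simp
  also have "\<dots> = emeasure lborel ((\<lambda>t. 2 * t) -` ?B) + emeasure lborel ((\<lambda>t. - 2 * t) -` ?B)"
    by (rule plus_emeasure[symmetric]) auto
  also have "\<dots> = (ennreal (1/2) + ennreal (1/2)) * emeasure lborel ?B"
    by (simp only: half abs_minus_cancel abs_numeral distrib_right)
  also have "ennreal (1/2) + ennreal (1/2) = 1"
    by (subst ennreal_plus[symmetric]) auto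
  finally show ?thesis
    by simp
qed

section \<open>Gluing countably many finite measures along the half-line\<close>

text \<open>The cell \<open>{s i<..<s (Suc i)}\<close> has length equal to the mass of
  \<open>M i\<close>, and there \<open>e\<close> is the quantile function of \<open>M i\<close>
  shifted to start at \<open>s i\<close>. Since the partial sums \<open>s\<close> are unbounded, the
  cells miss only countably many points of the half-line.\<close>

lemma lborel_transport_half_line:
  fixes M :: "nat \<Rightarrow> real measure"
  assumes fin: "\<And>i. finite_borel_measure (M i)"
    and inf: "(\<Sum>i. emeasure (M i) UNIV) = \<infinity>"
  shows "\<exists>e \<in> borel_measurable borel. \<forall>A \<in> sets borel.
    emeasure lborel ({0::real<..} \<inter> e -` A) = (\<Sum>i. emeasure (M i) A)"
proof -
  obtain q where q[measurable]: "\<And>i. q i \<in> borel_measurable borel"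
    and q_eq: "\<And>i A. A \<in> sets borel \<Longrightarrow>
      emeasure lborel ({0<..<measure (M i) UNIV} \<inter> q i -` A) = emeasure (M i) A"
  proof -
    have "\<forall>i. \<exists>q. q \<in> borel_measurable borel \<and> (\<forall>A\<in>sets borel.
        emeasure lborel ({0<..<measure (M i) UNIV} \<inter> q -` A) = emeasure (M i) A)"
      using finite_borel_measure_quantile[OF fin] unfolding Bex_def by (rule allI)
    then have "\<exists>q. \<forall>i. q i \<in> borel_measurable borel \<and> (\<forall>A\<in>sets borel.
        emeasure lborel ({0<..<measure (M i) UNIV} \<inter> q i -` A) = emeasure (M i) A)"
      by (rule choice)
    then show ?thesis
      using that by auto
  qed
  define s where "s n = (\<Sum>i<n. measure (M i) UNIV)" for n
  have s_Suc: "s (Suc n) = s n + measure (M n) UNIV" for n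
    by (simp add: s_def)
  have s_mono: "i \<le> j \<Longrightarrow> s i \<le> s j" for i j
    by (rule lift_Suc_mono_le[of s]) (auto simp: s_Suc)
  have s_unbounded: "\<exists>n. t < s n" for t
  proof (rule ccontr)
    assume "\<nexists>n. t < s n"
    then have le: "s n \<le> t" for n
      by (simp add: not_less)
    have "(\<Sum>i<n. emeasure (M i) UNIV) = ennreal (s n)" for n
      using finite_measure.emeasure_eq_measure[OF finite_borel_measure.axioms(1)[OF fin]]
      by (simp add: s_def)
    then have "(\<Sum>i. emeasure (M i) UNIV) \<le> ennreal t"
      using le by (intro suminf_le_const) (auto intro: ennreal_leI)
    with inf show False
      by (simp add: top_unique)
  qed
  \<comment> \<open>The index of the cell containing \<open>t\<close>; summands of mass zero give
    empty cells and are skipped by the strict inequality.\<close>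
  define J where "J t = (LEAST n. t < s (Suc n))" for t
  have [measurable]: "J \<in> borel \<rightarrow>\<^sub>M count_space UNIV"
    unfolding J_def by measurable
  have J_eq: "J t = i" if "s i < t" "t < s (Suc i)" for t i
    unfolding J_def
  proof (rule Least_equality)
    show "i \<le> n" if "t < s (Suc n)" for n
      using s_mono[of "Suc n" i] \<open>s i < t\<close> that by (cases "i \<le> n") auto
  qed fact
  define e where "e t = q (J t) (t - s (J t))" for t
  have e[measurable]: "e \<in> borel_measurable borel"
    \<comment> \<open>\<open>J\<close> has countably many values, so \<open>e\<close> is pieced
      together from countably many Borel functions.\<close>
    unfolding e_def by (rule measurable_compose_countable) measurable
  have "emeasure lborel ({0<..} \<inter> e -` A) = (\<Sum>i. emeasure (M i) A)"
    if A[measurable]: "A \<in> sets borel" for A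
  proof -
    have vim[measurable]: "f -` A \<in> sets borel" if "f \<in> borel_measurable borel" for f :: "real \<Rightarrow> real"
      using measurable_sets[OF that A] by simp
    have "emeasure lborel ({0<..} \<inter> e -` A) =
        emeasure lborel (\<Union>i. {s i<..<s (Suc i)} \<inter> e -` A)"
    proof (rule emeasure_eq_AE)
      \<comment> \<open>The cells are open; their endpoints form a countable, hence null,
        set.\<close>
      have "AE t in lborel. \<forall>i. t \<noteq> s i"
        by (simp add: AE_all_countable AE_lborel_singleton)
      then show "AE t in lborel. (t \<in> {0<..} \<inter> e -` A) =
          (t \<in> (\<Union>i. {s i<..<s (Suc i)} \<inter> e -` A))"
      proof eventually_elim
        fix t assume t: "\<forall>i. t \<noteq> s i"
        have "\<exists>i. s i < t \<and> t < s (Suc i)" if "0 < t"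
        proof -
          \<comment> \<open>The first partial sum beyond \<open>t\<close> is the right end of its
            cell; it is not \<open>s 0 = 0\<close>, so it has a predecessor, the left end.\<close>
          obtain n where n: "t < s n" "\<And>m. m < n \<Longrightarrow> \<not> t < s m"
            using s_unbounded[of t] exists_least_iff[of "\<lambda>n. t < s n"] by blast
          from n(1) that have "n \<noteq> 0"
            by (intro notI) (simp add: s_def)
          then obtain m where "n = Suc m"
            by (cases n) auto
          with n t show ?thesis
            by (metis lessI linorder_neqE_linordered_idom)
        qed
        moreover have "0 < t" if "s i < t" for i
          using s_mono[of 0 i] that by (simp add: s_def)
        ultimately show "(t \<in> {0<..} \<inter> e -` A) =
            (t \<in> (\<Union>i. {s i<..<s (Suc i)} \<inter> e -` A))"
          by auto
      qed
    qed (use e in measurable)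
    also have "\<dots> = (\<Sum>i. emeasure lborel ({s i<..<s (Suc i)} \<inter> e -` A))"
    proof (rule suminf_emeasure[symmetric])
      show "disjoint_family (\<lambda>i. {s i<..<s (Suc i)} \<inter> e -` A)"
        unfolding disjoint_family_on_def
      proof safe
        fix i j t
        assume "i \<noteq> j" "t \<in> {s i<..<s (Suc i)}" "t \<in> {s j<..<s (Suc j)}"
        then have False
          using J_eq[of i t] J_eq[of j t] by simp
        then show "t \<in> {}" ..
      qed
    qed (use e in auto)
    also have "\<dots> = (\<Sum>i. emeasure (M i) A)"
    proof (rule suminf_cong)
      fix i
      have "{s i<..<s (Suc i)} \<inter> e -` A =
          (\<lambda>t. t - s i) -` ({0<..<measure (M i) UNIV} \<inter> q i -` A)"
        using J_eq by (auto simp: e_def s_Suc)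
      then show "emeasure lborel ({s i<..<s (Suc i)} \<inter> e -` A) = emeasure (M i) A"
        by (simp only: emeasure_lborel_translate q_eq sets.Int vim A q borel_open open_greaterThanLessThan)
    qed
    finally show ?thesis .
  qed
  with e show ?thesis
    by (auto intro!: bexI[of _ e])
qed

section \<open>Coding points of a standard Borel space by real numbers\<close>

text \<open>Digits 0 and 1 in base 4 can be read off without ambiguity: after the shift, the earlier
  digits contribute a multiple of 4 and the later ones at most 1/3, so the parity of the integer
  part is digit \<open>i\<close>. In base 2 a tail of ones could carry.\<close>

lemma odd_floor_base4:
  fixes b :: "nat \<Rightarrow> bool"
  shows "odd \<lfloor>4 ^ Suc i * (\<Sum>k. of_bool (b k) / 4 ^ Suc k :: real)\<rfloor> \<longleftrightarrow> b i"
proof -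
  let ?f = "\<lambda>k. of_bool (b k) / 4 ^ Suc k :: real"
  have geo: "(\<lambda>k. (1/4) ^ k :: real) sums (4/3)"
    using geometric_sums[of "1/4::real"] by simp
  have summ: "summable ?f"
    by (rule summable_comparison_test'[OF sums_summable[OF geo], of 0])
       (auto simp: power_divide field_simps)
  define m :: int where "m = (\<Sum>k<i. of_bool (b k) * 4 ^ (i - k))"
  define r where "r = 4 ^ Suc i * (\<Sum>k. ?f (k + Suc i))"
  have "4 ^ Suc i * ?f k = of_int (of_bool (b k) * 4 ^ (i - k))" if "k < i" for k
  proof -
    have "(4::real) ^ i = 4 ^ k * 4 ^ (i - k)"
      using that by (simp flip: power_add)
    then show ?thesis
      by simp
  qed
  then have "4 ^ Suc i * (\<Sum>k<i. ?f k) = of_int m"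
    unfolding m_def sum_distrib_left of_int_sum by (intro sum.cong) auto
  then have split: "4 ^ Suc i * (\<Sum>k. ?f k) = of_int (m + of_bool (b i)) + r"
    using suminf_split_initial_segment[OF summ, of "Suc i"] by (simp add: r_def distrib_left)
  have r_eq: "r = (\<Sum>k. of_bool (b (k + Suc i)) / 4 ^ Suc k)"
    unfolding r_def using summable_iff_shift[of ?f "Suc i"] summ
    by (subst suminf_mult[symmetric]) (auto simp: power_add)
  have summ': "summable (\<lambda>k. of_bool (b (k + Suc i)) / 4 ^ Suc k :: real)"
    by (rule summable_comparison_test'[OF sums_summable[OF geo], of 0])
       (auto simp: power_divide field_simps)
  have "r \<le> (\<Sum>k. (1/4) * (1/4) ^ k)"
    unfolding r_eq using sums_summable[OF geo]
    by (intro suminf_le summ' summable_mult) (auto simp: power_divide)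
  also have "\<dots> = 1/3"
    using sums_unique[OF sums_mult[OF geo, of "1/4"]] by simp
  finally have "r < 1"
    by simp
  moreover have "0 \<le> r"
    unfolding r_eq by (intro suminf_nonneg summ') auto
  ultimately have "\<lfloor>4 ^ Suc i * (\<Sum>k. ?f k)\<rfloor> = m + of_bool (b i)"
    unfolding split by (intro floor_unique) auto
  moreover have "even m"
    unfolding m_def by (intro dvd_sum) auto
  ultimately show ?thesis
    by simp
qed

text \<open>A point is coded by the bits telling which balls of radius \<open>2\<^sup>-\<^sup>n\<close> around a dense sequence
  contain it; decoding is a limit of centres, so the range of the code need not be shown to be Borel.\<close>

lemma standard_borel_retract_real:
  assumes "standard_borel T" and "space T \<noteq> {}"
  obtains h :: "'a \<Rightarrow> real" and g :: "real \<Rightarrow> 'a"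
  where "h \<in> borel_measurable T" "g \<in> borel \<rightarrow>\<^sub>M T" "\<And>x. x \<in> space T \<Longrightarrow> g (h x) = x"
proof -
  obtain m :: "'a metric" where m: "mspace m = space T" "mcomplete_of m"
    "separable_space (mtopology_of m)"
    "sets T = sigma_sets (mspace m) {U. openin (mtopology_of m) U}"
    using assms(1) unfolding standard_borel_def by auto
  define d where "d = mdist m"
  interpret Metric_space "space T" d
    unfolding d_def m(1)[symmetric] by (rule Metric_space_mspace_mdist)
  have top: "mtopology_of m = mtopology"
    by (simp add: mtopology_of_def m(1) d_def)
  have complete: "mcomplete"
    using m(2) by (simp add: mcomplete_of_def m(1) d_def)
  obtain D where D: "countable D" "D \<subseteq> space T" "mtopology closure_of D = space T"
    using m(3) unfolding top separable_space_def by auto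
  have "D \<noteq> {}"
    using D(3) assms(2) by auto
  define c where "c = from_nat_into D"
  have c[simp]: "c k \<in> space T" for k
    using from_nat_into[OF \<open>D \<noteq> {}\<close>] D(2) by (auto simp: c_def)
  have dense: "\<exists>k. x \<in> mball (c k) r" if x: "x \<in> space T" "0 < r" for x r
  proof -
    obtain y where "y \<in> D" "y \<in> mball x r"
      using D(3) x unfolding metric_closure_of by blast
    then show ?thesis
      using from_nat_into_surj[OF D(1), of y] by (auto simp: c_def commute)
  qed
  define \<epsilon> :: "nat \<Rightarrow> real" where "\<epsilon> n = (1/2) ^ n" for n
  have \<epsilon>_pos[simp]: "0 < \<epsilon> n" for n
    by (simp add: \<epsilon>_def)
  have \<epsilon>_mono: "n \<le> n' \<Longrightarrow> \<epsilon> n' \<le> \<epsilon> n" for n n'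
    by (simp add: \<epsilon>_def power_decreasing)
  have \<epsilon>_small: "\<exists>n. \<epsilon> n < r" if "0 < r" for r
    using real_arch_pow_inv[OF that, of "1/2"] by (auto simp: \<epsilon>_def)

  \<comment> \<open>The index \<open>i\<close> encodes a pair: the number of a centre and the
    exponent of a radius.\<close>
  define B where "B i x \<longleftrightarrow> x \<in> mball (c (fst (prod_decode i))) (\<epsilon> (snd (prod_decode i)))" for i x
  define h where "h x = (\<Sum>i. of_bool (B i x) / 4 ^ Suc i :: real)" for x
  have [measurable]: "mball (c k) r \<in> sets T" for k r
    unfolding m(4) top by (rule sigma_sets.Basic) simp
  have [measurable]: "Measurable.pred T (B i)" for i
    unfolding B_def by measurable
  have h: "h \<in> borel_measurable T"
    unfolding h_def by measurable

  \<comment> \<open>Decoding at scale \<open>n\<close>: the first centre whose bit for radius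
    \<open>\<epsilon> n\<close> is set in \<open>r\<close>. For a genuine code \<open>h x\<close>
    density provides such a centre.\<close>
  define y where "y n r = (LEAST k. odd \<lfloor>4 ^ Suc (prod_encode (k, n)) * r\<rfloor>)" for n and r :: real
  have y[measurable]: "y n \<in> borel \<rightarrow>\<^sub>M count_space UNIV" for n
    unfolding y_def by measurable
  have y_h: "d (c (y n (h x))) x < \<epsilon> n" if "x \<in> space T" for n x
  proof -
    have "odd \<lfloor>4 ^ Suc (prod_encode (k, n)) * h x\<rfloor> \<longleftrightarrow> x \<in> mball (c k) (\<epsilon> n)" for k
      unfolding h_def odd_floor_base4 by (simp add: B_def)
    then have "y n (h x) = (LEAST k. x \<in> mball (c k) (\<epsilon> n))"
      by (simp add: y_def)
    then have "x \<in> mball (c (y n (h x))) (\<epsilon> n)"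
      using LeastI_ex[OF dense[OF that \<epsilon>_pos]] by metis
    then show ?thesis
      by simp
  qed

  \<comment> \<open>A Borel condition standing in for membership in the range of \<open>h\<close>:
    every code satisfies it, by the triangle inequality through the coded point, and it makes the
    decoded centres a Cauchy sequence.\<close>
  define ok where "ok r \<longleftrightarrow> (\<forall>n n'. d (c (y n r)) (c (y n' r)) \<le> \<epsilon> n + \<epsilon> n')" for r
  \<comment> \<open>The indices range over a countable discrete space, so every relation
    \<open>P\<close> between them is measurable.\<close>
  have [measurable]: "Measurable.pred borel (\<lambda>r. P (y n r) (y n' r))" for P n n'
    by measurable
  have [measurable]: "Measurable.pred borel ok"
    unfolding ok_def by measurable
  have "\<exists>x\<in>space T. \<forall>n. d (c (y n r)) x \<le> \<epsilon> n" if "ok r" for r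
  proof -
    let ?p = "\<lambda>n. c (y n r)"
    have "MCauchy ?p"
      unfolding MCauchy_def
    proof safe
      fix \<delta> :: real assume "0 < \<delta>"
      then obtain N where N: "\<epsilon> N < \<delta> / 2"
        using \<epsilon>_small[of "\<delta> / 2"] by auto
      have "d (?p n) (?p n') < \<delta>" if "N \<le> n" "N \<le> n'" for n n'
        using \<open>ok r\<close> \<epsilon>_mono[OF that(1)] \<epsilon>_mono[OF that(2)] N
        unfolding ok_def by (smt (verit) field_sum_of_halves)
      then show "\<exists>N. \<forall>n n'. N \<le> n \<longrightarrow> N \<le> n' \<longrightarrow> d (?p n) (?p n') < \<delta>"
        by blast
    qed auto
    then obtain x where x: "limitin mtopology ?p x sequentially"
      using complete unfolding mcomplete_def by blast
    then have xT: "x \<in> space T"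
      using limitin_mspace by blast
    \<comment> \<open>Let the second index in \<open>ok\<close> tend to infinity.\<close>
    have "d (?p n) x \<le> \<epsilon> n" for n
    proof (rule field_le_epsilon)
      fix \<delta> :: real assume "0 < \<delta>"
      then obtain N where N: "\<epsilon> N < \<delta> / 2"
        using \<epsilon>_small[of "\<delta> / 2"] by auto
      obtain N' where N': "\<And>n. N' \<le> n \<Longrightarrow> d (?p n) x < \<delta> / 2"
        using x \<open>0 < \<delta>\<close> unfolding limit_metric_sequentially by (metis half_gt_zero)
      let ?k = "max N N'"
      have "d (?p n) x \<le> d (?p n) (?p ?k) + d (?p ?k) x"
        using xT by (intro triangle) auto
      also have "d (?p n) (?p ?k) \<le> \<epsilon> n + \<epsilon> ?k"
        using \<open>ok r\<close> by (simp add: ok_def)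
      finally show "d (?p n) x \<le> \<epsilon> n + \<delta>"
        using N'[of ?k] \<epsilon>_mono[of N ?k] N by simp
    qed
    with xT show ?thesis
      by blast
  qed
  then obtain l where l: "\<And>r. ok r \<Longrightarrow> l r \<in> space T" "\<And>r n. ok r \<Longrightarrow> d (c (y n r)) (l r) \<le> \<epsilon> n"
    by metis
  obtain z where z: "z \<in> space T"
    using assms(2) by blast
  define g where "g r = (if ok r then l r else z)" for r
  \<comment> \<open>The closed balls all contain the limit and shrink to it: once
    \<open>\<epsilon> n < \<delta> / 2\<close>, the ball lies in
    \<open>mball (l r) \<delta>\<close>. Membership in an open set thus becomes a countable
    disjunction of conditions on the indices \<open>y n r\<close>, which makes \<open>g\<close>
    measurable.\<close>
  have l_iff: "l r \<in> U \<longleftrightarrow> (\<exists>n. mcball (c (y n r)) (\<epsilon> n) \<subseteq> U)"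
    if "ok r" and U: "openin mtopology U" for r U
  proof
    assume "l r \<in> U"
    then obtain \<delta> where \<delta>: "0 < \<delta>" "mball (l r) \<delta> \<subseteq> U"
      using U unfolding openin_mtopology by blast
    obtain n where n: "\<epsilon> n < \<delta> / 2"
      using \<epsilon>_small[of "\<delta> / 2"] \<delta>(1) by auto
    have "d (l r) x < \<delta>" if "x \<in> space T" "d (c (y n r)) x \<le> \<epsilon> n" for x
      using triangle[of "l r" "c (y n r)" x] l(1)[OF \<open>ok r\<close>] l(2)[OF \<open>ok r\<close>, of n] that n
      by (simp add: commute)
    then have "mcball (c (y n r)) (\<epsilon> n) \<subseteq> mball (l r) \<delta>"
      using l(1)[OF \<open>ok r\<close>] by auto
    with \<delta>(2) show "\<exists>n. mcball (c (y n r)) (\<epsilon> n) \<subseteq> U"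
      by blast
  next
    assume "\<exists>n. mcball (c (y n r)) (\<epsilon> n) \<subseteq> U"
    then show "l r \<in> U"
      using l[OF \<open>ok r\<close>] by auto
  qed
  have g: "g \<in> borel \<rightarrow>\<^sub>M T"
  proof (rule measurable_sigma_sets[OF m(4)])
    show "{U. openin (mtopology_of m) U} \<subseteq> Pow (mspace m)"
      using openin_subset[of "mtopology_of m"] by auto
    show "g \<in> space borel \<rightarrow> mspace m"
      using l(1) z by (auto simp: g_def m(1))
    fix U assume "U \<in> {U. openin (mtopology_of m) U}"
    then have U: "openin mtopology U"
      by (simp add: top)
    have "g -` U \<inter> space borel =
        {r. if ok r then \<exists>n. mcball (c (y n r)) (\<epsilon> n) \<subseteq> U else z \<in> U}"
      by (simp add: g_def l_iff[OF _ U] vimage_def if_distrib[of "\<lambda>x. x \<in> U"] cong: if_cong)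
    also have "\<dots> \<in> sets borel"
      by measurable
    finally show "g -` U \<inter> space borel \<in> sets borel" .
  qed
  have "g (h x) = x" if x: "x \<in> space T" for x
  proof -
    have "ok (h x)"
      unfolding ok_def
    proof safe
      fix n n'
      show "d (c (y n (h x))) (c (y n' (h x))) \<le> \<epsilon> n + \<epsilon> n'"
        using triangle[of "c (y n (h x))" x "c (y n' (h x))"] y_h[OF x, of n] y_h[OF x, of n'] x
        by (simp add: commute)
    qed
    note l = l[OF this]
    \<comment> \<open>Both points are within \<open>\<epsilon> n\<close> of the same centre for
      every \<open>n\<close>.\<close>
    have "d (l (h x)) x \<le> 0"
    proof (rule ccontr)
      assume "\<not> ?thesis"
      then obtain n where "\<epsilon> n < d (l (h x)) x / 2"
        using \<epsilon>_small[of "d (l (h x)) x / 2"] by auto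
      then show False
        using triangle[of "l (h x)" "c (y n (h x))" x] y_h[OF x, of n] l(1) l(2)[of n] x
        by (simp add: commute)
    qed
    then have "l (h x) = x"
      using l(1) x by (metis nonneg order_antisym zero)
    with \<open>ok (h x)\<close> show ?thesis
      by (simp add: g_def)
  qed
  with h g show ?thesis
    by (rule that)
qed

section \<open>Pushforwards of Lebesgue measure and infinite total mass\<close>

theorem theorem17:
  fixes T \<sigma> :: "'a measure"
  assumes "standard_borel T"
    and "sets \<sigma> = sets T"
    and "s_finite_measure \<sigma>"
  shows "(\<exists>d :: real \<Rightarrow> 'a. d \<in> borel \<rightarrow>\<^sub>M T \<and> \<sigma> = distr lborel T d) \<longleftrightarrow>
    emeasure \<sigma> (space T) = \<infinity>"
proof
  assume "\<exists>d :: real \<Rightarrow> 'a. d \<in> borel \<rightarrow>\<^sub>M T \<and> \<sigma> = distr lborel T d"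
  then obtain d :: "real \<Rightarrow> 'a" where d[measurable]: "d \<in> borel \<rightarrow>\<^sub>M T" "\<sigma> = distr lborel T d"
    by blast
  \<comment> \<open>As \<open>d\<close> is total, the total mass of \<open>\<sigma>\<close> is that
    of the whole line.\<close>
  have "d -` space T = UNIV"
    using measurable_space[OF d(1)] by auto
  then show "emeasure \<sigma> (space T) = \<infinity>"
    by (simp add: d(2) emeasure_distr)
next
  assume inf: "emeasure \<sigma> (space T) = \<infinity>"
  then have "space T \<noteq> {}"
    by auto
  obtain h :: "'a \<Rightarrow> real" and g :: "real \<Rightarrow> 'a"
    where h[measurable]: "h \<in> borel_measurable T" and g[measurable]: "g \<in> borel \<rightarrow>\<^sub>M T"
      and gh: "\<And>x. x \<in> space T \<Longrightarrow> g (h x) = x"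
    using standard_borel_retract_real[OF assms(1) \<open>space T \<noteq> {}\<close>] by blast
  obtain \<mu> :: "nat \<Rightarrow> 'a measure"
    where \<mu>: "\<And>i. sets (\<mu> i) = sets T" "\<And>i. finite_measure (\<mu> i)"
      and sum: "\<And>A. A \<in> sets T \<Longrightarrow> emeasure \<sigma> A = (\<Sum>i. emeasure (\<mu> i) A)"
    using assms(3) unfolding s_finite_measure_def assms(2) by blast
  note [measurable_cong] = \<mu>(1)
  have space_\<mu>: "space (\<mu> i) = space T" for i
    by (rule sets_eq_imp_space_eq[OF \<mu>(1)])
  define M where "M i = distr (\<mu> i) borel h" for i
  have M_eq: "emeasure (M i) A = emeasure (\<mu> i) (h -` A \<inter> space T)" if "A \<in> sets borel" for i A
    using that by (simp add: M_def emeasure_distr space_\<mu>)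
  have "finite_borel_measure (M i)" for i
    unfolding finite_borel_measure_def finite_borel_measure_axioms_def M_def
    by (simp add: finite_measure.finite_measure_distr[OF \<mu>(2)])
  moreover have "(\<Sum>i. emeasure (M i) UNIV) = \<infinity>"
    using sum[of "space T"] inf by (simp add: M_eq)
  ultimately have "\<exists>e \<in> borel_measurable borel. \<forall>A \<in> sets borel.
      emeasure lborel ({0::real<..} \<inter> e -` A) = (\<Sum>i. emeasure (M i) A)"
    by (rule lborel_transport_half_line)
  then obtain e :: "real \<Rightarrow> real" where e[measurable]: "e \<in> borel_measurable borel"
    and e_eq: "\<And>A. A \<in> sets borel \<Longrightarrow>
      emeasure lborel ({0<..} \<inter> e -` A) = (\<Sum>i. emeasure (M i) A)"
    by auto
  \<comment> \<open>Fold the line onto the half-line, transport to the sum of the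
    \<open>M i\<close>, then return to \<open>T\<close> along the retraction.\<close>
  define d where "d t = g (e (2 * \<bar>t\<bar>))" for t
  have d: "d \<in> borel \<rightarrow>\<^sub>M T"
    unfolding d_def by measurable
  have "\<sigma> = distr lborel T d"
  proof (rule measure_eqI)
    show "sets \<sigma> = sets (distr lborel T d)"
      by (simp add: assms(2))
    fix A assume "A \<in> sets \<sigma>"
    then have A: "A \<in> sets T"
      by (simp add: assms(2))
    have gA: "g -` A \<in> sets borel"
      using measurable_sets[OF g A] by simp
    have egA: "e -` g -` A \<in> sets borel"
      using measurable_sets[OF e gA] by simp
    have "emeasure (distr lborel T d) A = emeasure lborel (d -` A)"
      using A d by (simp add: emeasure_distr)
    also have "d -` A = (\<lambda>t. 2 * \<bar>t\<bar>) -` e -` g -` A"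
      by (auto simp: d_def)
    also have "emeasure lborel \<dots> = (\<Sum>i. emeasure (M i) (g -` A))"
      by (simp add: emeasure_lborel_fold[OF egA] e_eq[OF gA])
    also have "\<dots> = (\<Sum>i. emeasure (\<mu> i) A)"
    proof -
      \<comment> \<open>Since \<open>g\<close> undoes \<open>h\<close> on \<open>T\<close>, pushing
        \<open>\<mu> i\<close> to the line and back leaves it unchanged.\<close>
      have "h -` g -` A \<inter> space T = A"
        using gh sets.sets_into_space[OF A] by auto
      then show ?thesis
        by (simp add: M_eq[OF gA])
    qed
    finally show "emeasure \<sigma> A = emeasure (distr lborel T d) A"
      by (simp add: sum[OF A])
  qed
  with d show "\<exists>d :: real \<Rightarrow> 'a. d \<in> borel \<rightarrow>\<^sub>M T \<and> \<sigma> = distr lborel T d"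
    by blast
qed

end
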